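(* Let $\mathcal{C}$ be a permutation class that is sum closed and rc-invariant. Then $$\liminf_{n\to\infty}|\mathcal{C}^{rc}_{2n}|^{1/n}\;\ge\;\lim_{n\to\infty}|\mathcal{C}_n|^{1/n}.$$
   Context: A permutation of size $n$ is a bijection of $[n]$; $\pi$ contains $\sigma$ if some subsequence of $\pi$ has the same relative order as $\sigma$; a permutation class is a set of permutations closed downward under containment; $\mathcal{C}_n$ is the set of size-$n$ elements of $\mathcal{C}$. For $\pi$ of size $n$, $\mathrm{rc}(\pi)(i)=n+1-\pi(n+1-i)$; $\pi$ is centrosymmetric if $\mathrm{rc}(\pi)=\pi$; $\mathcal{C}^{rc}_n$ is the set of centrosymmetric elements of $\mathcal{C}_n$; $\mathcal{C}$ is rc-invariant if $\mathrm{rc}(\mathcal{C})=\mathcal{C}$. For $\sigma$ of size $a$ and $\tau$ of size $b$, the sum $\sigma\oplus\tau$ is the permutation of size $a+b$ with $(\sigma\oplus\tau)(i)=\sigma(i)$ for $i\le a$ and $(\sigma\oplus\tau)(i)=a+\tau(i-a)$ for $i>a$. $\mathcal{C}$ is sum closed if $\sigma,\tau\in\mathcal{C}$ implies $\sigma\oplus\tau\in\mathcal{C}$. (For sum closed classes the limit $\lim_n|\mathcal{C}_n|^{1/n}$ is known to exist.) *)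

theory Defs
  imports Complex_Main "HOL-Combinatorics.Permutations" "HOL-Library.Extended_Real"
begin

text \<open>
  A permutation is paired with its size, because \<^term>\<open>\<pi> permutes {1..n}\<close> alone does not determine
  \<^term>\<open>n\<close>. Since \<open>permutes\<close> fixes every point outside \<open>{1..n}\<close>, equality of such pairs is equality of
  bijections of \<open>{1..n}\<close>. The empty permutation, of size 0, is included.
\<close>

type_synonym sized_perm = "nat \<times> (nat \<Rightarrow> nat)"

definition is_perm :: "sized_perm \<Rightarrow> bool" where
  "is_perm p \<longleftrightarrow> snd p permutes {1..fst p}"

definition contains :: "sized_perm \<Rightarrow> sized_perm \<Rightarrow> bool" where
  "contains p q \<longleftrightarrow>
     (\<exists>f. strict_mono_on {1..fst q} f \<and> f ` {1..fst q} \<subseteq> {1..fst p} \<and>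
       (\<forall>i\<in>{1..fst q}. \<forall>j\<in>{1..fst q}. snd q i < snd q j \<longleftrightarrow> snd p (f i) < snd p (f j)))"

definition permutation_class :: "sized_perm set \<Rightarrow> bool" where
  "permutation_class C \<longleftrightarrow>
     (\<forall>p\<in>C. is_perm p) \<and> (\<forall>p\<in>C. \<forall>q. is_perm q \<and> contains p q \<longrightarrow> q \<in> C)"

definition of_size :: "sized_perm set \<Rightarrow> nat \<Rightarrow> sized_perm set" where
  "of_size C n = {p \<in> C. fst p = n}"

definition rc :: "sized_perm \<Rightarrow> sized_perm" where
  "rc p = (fst p, \<lambda>i. if i \<in> {1..fst p} then fst p + 1 - snd p (fst p + 1 - i) else i)"

definition centrosymmetric :: "sized_perm \<Rightarrow> bool" where
  "centrosymmetric p \<longleftrightarrow> rc p = p"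

definition centrosymmetric_of_size :: "sized_perm set \<Rightarrow> nat \<Rightarrow> sized_perm set" where
  "centrosymmetric_of_size C n = {p \<in> of_size C n. centrosymmetric p}"

definition rc_invariant :: "sized_perm set \<Rightarrow> bool" where
  "rc_invariant C \<longleftrightarrow> rc ` C = C"

text \<open>Points beyond the total size need no separate case: there the second summand is the identity.\<close>

definition perm_sum :: "sized_perm \<Rightarrow> sized_perm \<Rightarrow> sized_perm" where
  "perm_sum p q =
     (fst p + fst q, \<lambda>i. if i \<le> fst p then snd p i else fst p + snd q (i - fst p))"

definition sum_closed :: "sized_perm set \<Rightarrow> bool" where
  "sum_closed C \<longleftrightarrow> (\<forall>p\<in>C. \<forall>q\<in>C. perm_sum p q \<in> C)"

end

theory Submission imports Defs begin

text \<open>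
  The map \<open>\<pi> \<mapsto> \<pi> \<oplus> rc(\<pi>)\<close> is injective and sends the elements of size \<open>n\<close> of the class to centrosymmetric
  elements of size \<open>2n\<close>. The growth rate exists because direct sums make the counting sequence
  supermultiplicative, so Fekete's argument applies; the limit may be infinite.
\<close>

section \<open>Fekete's argument for supermultiplicative sequences\<close>

lemma supermultiplicative_power_le:
  fixes a :: "nat \<Rightarrow> real"
  assumes ge1: "\<And>n. 1 \<le> a n" and super: "\<And>m n. a m * a n \<le> a (m + n)"
  shows "a m ^ q \<le> a (q * m)"
proof (induction q)
  case (Suc q)
  have "a m * a m ^ q \<le> a m * a (q * m)"
    using Suc ge1[of m] by (intro mult_left_mono) auto
  also have "\<dots> \<le> a (m + q * m)" by (rule super)
  finally show ?case by simp
qed (use ge1 in simp)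

text \<open>Rounding in \<open>n div m\<close> loses less than 1, hence at most \<open>1 / n\<close>
  after division by \<open>n\<close>. This is the limit of the exponent that arises in Fekete's
  argument.\<close>

lemma div_over_self_tendsto:
  fixes m :: nat
  assumes "0 < m"
  shows "(\<lambda>n. real (n div m) / real n) \<longlonglongrightarrow> 1 / real m"
proof (rule tendsto_sandwich)
  show "\<forall>\<^sub>F n in sequentially. 1 / real m - 1 / real n \<le> real (n div m) / real n"
    using eventually_gt_at_top[of 0]
  proof eventually_elim
    case (elim n)
    have "n = m * (n div m) + n mod m" by simp
    also have "\<dots> \<le> m * (n div m) + m"
      using assms by (intro add_left_mono less_imp_le) simp
    finally have "real n \<le> real m * real (n div m) + real m"
      by (simp flip: of_nat_add of_nat_mult)
    then have "real n / (real m * real n) \<le> (real m * real (n div m) + real m) / (real m * real n)"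
      by (intro divide_right_mono) auto
    with elim assms show ?case by (simp add: add_divide_distrib algebra_simps)
  qed
  show "\<forall>\<^sub>F n in sequentially. real (n div m) / real n \<le> 1 / real m"
    using eventually_gt_at_top[of 0]
  proof eventually_elim
    case (elim n)
    have "real (n div m) * real m \<le> real n"
      by (simp flip: of_nat_mult)
    with elim assms show ?case by (simp add: field_simps)
  qed
  show "(\<lambda>n. 1 / real m - 1 / real n) \<longlonglongrightarrow> 1 / real m"
    using tendsto_diff[OF tendsto_const lim_1_over_n, of "1 / real m"] by simp
qed simp

text \<open>Every term \<open>root m (a m)\<close> with \<open>m > 0\<close> is a lower bound for
  the liminf, which therefore dominates the limsup. Nothing bounds \<open>a\<close> from above, so
  convergence is taken in \<open>ereal\<close>, where the limit may be infinite.\<close>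

lemma supermultiplicative_root_convergent:
  fixes a :: "nat \<Rightarrow> real"
  assumes ge1: "\<And>n. 1 \<le> a n" and super: "\<And>m n. a m * a n \<le> a (m + n)"
  shows "convergent (\<lambda>n. ereal (root n (a n)))"
proof -
  let ?r = "\<lambda>n. ereal (root n (a n))"
  have pos: "0 < a n" for n using ge1[of n] by simp
  have lower: "?r m \<le> liminf ?r" if "0 < m" for m
  proof -
    \<comment> \<open>For fixed \<open>m\<close>, this is the \<open>n\<close>-th root of
      \<open>a m ^ (n div m)\<close>, a minorant of \<open>root n (a n)\<close> whose limit is
      \<open>root m (a m)\<close>.\<close>
    have "(\<lambda>n. a m powr (real (n div m) / real n)) \<longlonglongrightarrow> a m powr (1 / real m)"
      using pos[of m] by (intro tendsto_powr tendsto_const div_over_self_tendsto that) simp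
    then have lim: "(\<lambda>n. ereal (a m powr (real (n div m) / real n))) \<longlonglongrightarrow> ?r m"
      using that pos[of m] by (simp add: root_powr_inverse)
    have "a m powr (real (n div m) / real n) \<le> root n (a n)" if "0 < n" for n
    proof -
      have "a m ^ (n div m) \<le> a (n div m * m)"
        by (rule supermultiplicative_power_le[OF ge1 super])
      \<comment> \<open>The remainder of the division contributes a factor of at least 1.\<close>
      also have "\<dots> \<le> a (n div m * m) * a (n mod m)"
        using ge1[of "n mod m"] pos[of "n div m * m"] by simp
      also have "\<dots> \<le> a n"
        using super[of "n div m * m" "n mod m"] by simp
      finally have "root n (a m ^ (n div m)) \<le> root n (a n)"
        using that by simp
      moreover have "root n (a m ^ (n div m)) = a m powr (real (n div m) / real n)"
      proof -
        have "root n (a m ^ (n div m)) = (a m powr real (n div m)) powr (1 / real n)"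
          using that pos[of m] by (simp add: root_powr_inverse powr_realpow)
        then show ?thesis by (simp add: powr_powr)
      qed
      ultimately show ?thesis by simp
    qed
    then have "\<forall>\<^sub>F n in sequentially. ereal (a m powr (real (n div m) / real n)) \<le> ?r n"
      by (intro eventually_mono[OF eventually_gt_at_top[of 0]]) simp
    then have "liminf (\<lambda>n. ereal (a m powr (real (n div m) / real n))) \<le> liminf ?r"
      by (rule Liminf_mono)
    then show ?thesis
      using lim_imp_Liminf[OF _ lim] by simp
  qed
  have "limsup ?r \<le> liminf ?r"
    by (intro Limsup_bounded eventually_mono[OF eventually_gt_at_top[of 0]] lower)
  then have "liminf ?r = limsup ?r"
    by (intro antisym Liminf_le_Limsup) auto
  then show ?thesis
    by (intro convergentI[OF Liminf_eq_Limsup]) auto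
qed

section \<open>Growth rate of a sum closed class\<close>

lemma finite_of_size:
  assumes "permutation_class C"
  shows "finite (of_size C n)"
proof (rule finite_subset)
  show "of_size C n \<subseteq> {n} \<times> {p. p permutes {1..n}}"
    using assms by (auto simp: of_size_def permutation_class_def is_perm_def)
qed (simp add: finite_permutations)

text \<open>Equal sizes of the first summands fix where the sum is cut. Otherwise splittings are not
  unique: the permutation of size 1 can be cut before or after its only point.\<close>

lemma perm_sum_inject:
  assumes "is_perm p" "is_perm q" "is_perm p'" "is_perm q'"
    and size: "fst p = fst p'" and eq: "perm_sum p q = perm_sum p' q'"
  shows "p = p' \<and> q = q'"
proof -
  have size2: "fst q = fst q'"
    using size arg_cong[OF eq, of fst] by (simp add: perm_sum_def)
  have val: "(if i \<le> fst p then snd p i else fst p + snd q (i - fst p)) =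
      (if i \<le> fst p' then snd p' i else fst p' + snd q' (i - fst p'))" for i
    using fun_cong[OF arg_cong[OF eq, of snd], of i] unfolding perm_sum_def snd_conv .
  have "snd p i = snd p' i" for i
  proof (cases "i \<le> fst p")
    case True
    then show ?thesis using val[of i] size by simp
  next
    case False
    then show ?thesis
      using assms(1,3) size by (auto simp: is_perm_def permutes_not_in)
  qed
  moreover have "snd q i = snd q' i" for i
  \<comment> \<open>Index 0 is separate because position \<open>fst p\<close> still lies in the
    first block and says nothing about \<open>q\<close>.\<close>
  proof (cases "i = 0")
    case True
    then show ?thesis
      using assms(2,4) by (auto simp: is_perm_def permutes_not_in)
  next
    case False
    then show ?thesis using val[of "i + fst p"] size by simp
  qed
  ultimately show ?thesis
    using size size2 by (auto simp: prod_eq_iff)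
qed

lemma card_of_size_supermultiplicative:
  assumes C: "permutation_class C" and "sum_closed C"
  shows "card (of_size C m) * card (of_size C n) \<le> card (of_size C (m + n))"
proof -
  have "inj_on (\<lambda>(p, q). perm_sum p q) (of_size C m \<times> of_size C n)"
  proof (rule inj_onI, clarify)
    fix p q p' q'
    assume "p \<in> of_size C m" "q \<in> of_size C n" "p' \<in> of_size C m" "q' \<in> of_size C n"
      and "perm_sum p q = perm_sum p' q'"
    then show "p = p' \<and> q = q'"
      using C by (intro perm_sum_inject) (auto simp: of_size_def permutation_class_def)
  qed
  moreover have "(\<lambda>(p, q). perm_sum p q) ` (of_size C m \<times> of_size C n) \<subseteq> of_size C (m + n)"
    using assms(2) by (auto simp: of_size_def sum_closed_def perm_sum_def)
  ultimately have "card (of_size C m \<times> of_size C n) \<le> card (of_size C (m + n))"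
    by (rule card_inj_on_le) (rule finite_of_size[OF C])
  then show ?thesis by (simp add: card_cartesian_product)
qed

text \<open>A nonempty permutation contains the one of size 1, and repeated sums with the latter
  reach every size.\<close>

lemma card_of_size_pos:
  assumes C: "permutation_class C" and "sum_closed C" and p: "p \<in> C" and "0 < fst p"
  shows "0 < card (of_size C n)"
proof (induction n)
  case 0
  have "(0, id) \<in> C"
    using C p unfolding permutation_class_def
    by (auto simp: is_perm_def contains_def permutes_id strict_mono_on_def)
  then show ?case
    using finite_of_size[OF C, of 0] by (auto simp: card_gt_0_iff of_size_def)
next
  case (Suc n)
  have "contains p (1, id)"
    unfolding contains_def using \<open>0 < fst p\<close>
    \<comment> \<open>A one-point pattern embeds at any position, so a constant map serves; strict
      monotonicity is vacuous.\<close>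
    by (intro exI[of _ "\<lambda>_. 1"]) (auto simp: strict_mono_on_def)
  moreover have "is_perm (1, id)" by (simp add: is_perm_def permutes_id)
  ultimately have "(1, id) \<in> C"
    using C p unfolding permutation_class_def by blast
  then have "0 < card (of_size C 1)"
    using finite_of_size[OF C, of 1] by (auto simp: card_gt_0_iff of_size_def)
  then have "0 < card (of_size C 1) * card (of_size C n)"
    using Suc by simp
  also have "\<dots> \<le> card (of_size C (1 + n))"
    by (rule card_of_size_supermultiplicative[OF assms(1,2)])
  finally show ?case by simp
qed

text \<open>Fekete's argument needs all counts to be at least 1. This fails only if the class has no
  nonempty permutation, and then the roots are constantly 0.\<close>

lemma growth_rate_convergent:
  assumes C: "permutation_class C" and "sum_closed C"
  shows "convergent (\<lambda>n. ereal (root n (real (card (of_size C n)))))"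
proof (cases "\<exists>p\<in>C. 0 < fst p")
  case True
  then have "0 < card (of_size C n)" for n
    using card_of_size_pos[OF assms] by blast
  then have "1 \<le> real (card (of_size C n))" for n
    by (simp add: Suc_le_eq)
  moreover have "real (card (of_size C m)) * real (card (of_size C n))
      \<le> real (card (of_size C (m + n)))" for m n
    using card_of_size_supermultiplicative[OF assms, of m n] by (simp flip: of_nat_mult)
  ultimately show ?thesis
    by (rule supermultiplicative_root_convergent)
next
  case False
  then have "of_size C n = {}" if "0 < n" for n
    using that by (auto simp: of_size_def)
  \<comment> \<open>At \<open>n = 0\<close> the count may be 1, but \<open>root 0\<close> is 0 by
    convention.\<close>
  then have "root n (real (card (of_size C n))) = 0" for n
    by (cases "n = 0") auto
  then show ?thesis by (simp add: convergent_const)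
qed

section \<open>Centrosymmetric sums and the comparison of growth rates\<close>

lemma centrosymmetric_perm_sum_rc:
  assumes "is_perm p"
  shows "centrosymmetric (perm_sum p (rc p))"
proof -
  let ?n = "fst p"
  \<comment> \<open>This bound makes the truncated subtractions of \<open>rc\<close> cancel as they
    do over the integers.\<close>
  have bound: "snd p i \<le> ?n" if "i \<le> ?n" for i
  proof (cases "i = 0")
    case True
    then show ?thesis using assms by (auto simp: is_perm_def permutes_not_in)
  next
    case False
    then have "snd p i \<in> {1..?n}"
      using assms that permutes_in_image[of "snd p" "{1..?n}" i] by (simp add: is_perm_def)
    then show ?thesis by simp
  qed
  have zero: "snd p 0 = 0"
    using assms by (auto simp: is_perm_def permutes_not_in)
  have "snd (rc (perm_sum p (rc p))) i = snd (perm_sum p (rc p)) i" for i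
  proof -
    \<comment> \<open>The reflection of positions \<open>i\<close> to \<open>2 * ?n + 1 - i\<close>
      exchanges the two blocks, and applying \<open>rc\<close> twice to a block restores it. The
      outer two cases lie off the domain, where only the identity convention matters.\<close>
    consider "i = 0" | "1 \<le> i" "i \<le> ?n" | "?n < i" "i \<le> 2 * ?n" | "2 * ?n < i" by linarith
    then show ?thesis
    proof cases
      case 1
      then show ?thesis by (simp add: rc_def perm_sum_def zero)
    next
      case 2
      then have "?n + 1 - (2 * ?n + 1 - i - ?n) = i" "\<not> 2 * ?n + 1 - i \<le> ?n"
        by linarith+
      then show ?thesis
        using 2 bound[of i] by (auto simp: rc_def perm_sum_def)
    next
      case 3
      then have "?n + 1 - (i - ?n) = 2 * ?n + 1 - i" "2 * ?n + 1 - i \<le> ?n"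
        by linarith+
      then show ?thesis
        using 3 bound[of "2 * ?n + 1 - i"] by (auto simp: rc_def perm_sum_def)
    next
      case 4
      then show ?thesis by (auto simp: rc_def perm_sum_def)
    qed
  qed
  then show ?thesis
    by (auto simp: centrosymmetric_def prod_eq_iff rc_def)
qed

text \<open>Invariance puts \<open>rc p\<close> in the class and sum closure then keeps the image
  there. Since all \<open>p\<close> have size \<open>n\<close>, every sum is cut at \<open>n\<close>
  and \<open>p\<close> is recovered as its first summand.\<close>

lemma card_of_size_le_centrosymmetric:
  assumes C: "permutation_class C" and "sum_closed C" and "rc_invariant C"
  shows "card (of_size C n) \<le> card (centrosymmetric_of_size C (2 * n))"
proof (rule card_inj_on_le)
  have rc: "rc p \<in> C" if "p \<in> C" for p
    using assms(3) that unfolding rc_invariant_def by blast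
  have perm: "is_perm p" if "p \<in> C" for p
    using C that unfolding permutation_class_def by blast
  show "inj_on (\<lambda>p. perm_sum p (rc p)) (of_size C n)"
  proof (rule inj_onI)
    fix p q
    assume "p \<in> of_size C n" "q \<in> of_size C n" "perm_sum p (rc p) = perm_sum q (rc q)"
    then show "p = q"
      using perm_sum_inject[of p "rc p" q "rc q"] perm rc by (auto simp: of_size_def)
  qed
  show "(\<lambda>p. perm_sum p (rc p)) ` of_size C n \<subseteq> centrosymmetric_of_size C (2 * n)"
  proof (rule image_subsetI)
    fix p assume p: "p \<in> of_size C n"
    then have "perm_sum p (rc p) \<in> C"
      using assms(2) rc by (auto simp: of_size_def sum_closed_def)
    moreover have "fst (perm_sum p (rc p)) = 2 * n"
      using p by (simp add: perm_sum_def rc_def of_size_def)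
    ultimately show "perm_sum p (rc p) \<in> centrosymmetric_of_size C (2 * n)"
      using centrosymmetric_perm_sum_rc[of p] perm p
      by (auto simp: centrosymmetric_of_size_def of_size_def)
  qed
  show "finite (centrosymmetric_of_size C (2 * n))"
    using finite_of_size[OF C] by (simp add: centrosymmetric_of_size_def)
qed

theorem theorem1p3:
  fixes C :: "sized_perm set"
  assumes "permutation_class C"
    and "sum_closed C"
    and "rc_invariant C"
  shows "liminf (\<lambda>n. ereal (root n (real (card (centrosymmetric_of_size C (2 * n))))))
    \<ge> lim (\<lambda>n. ereal (root n (real (card (of_size C n)))))"
proof -
  \<comment> \<open>Convergence gives \<open>lim\<close> its meaning and identifies it with the
    liminf, so a termwise comparison suffices. Size \<open>2 * n\<close> is paired with the
    \<open>n\<close>-th root, so both sides use the same root.\<close>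
  have "lim (\<lambda>n. ereal (root n (real (card (of_size C n)))))
      = liminf (\<lambda>n. ereal (root n (real (card (of_size C n)))))"
    using lim_imp_Liminf[OF sequentially_bot growth_rate_convergent[OF assms(1,2),
      unfolded convergent_LIMSEQ_iff]] by simp
  also have "\<dots> \<le> liminf (\<lambda>n. ereal (root n (real (card (centrosymmetric_of_size C (2 * n))))))"
  proof (rule Liminf_mono)
    show "\<forall>\<^sub>F n in sequentially. ereal (root n (real (card (of_size C n))))
        \<le> ereal (root n (real (card (centrosymmetric_of_size C (2 * n)))))"
      using eventually_gt_at_top[of 0]
      by eventually_elim (simp add: card_of_size_le_centrosymmetric[OF assms])
  qed
  finally show ?thesis .
qed

end
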